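(* Let $G_0$ be the background Green's function for the diffusion equation with uniform absorption $\alpha_0$. If the potential $\eta$ is due to a single point absorber located at the vertex $y\in V$, i.e. $\eta=\kappa\,\delta_y$ with $\kappa$ a positive constant, then the Green's function $G$ of the diffusion equation with absorption $\alpha_0(1+\eta)$ satisfies $$G_0-G=\frac{\alpha_0\kappa}{1+\alpha_0\kappa\,G_0(y,y)}\,G_0(\cdot,y)\,G_0(\cdot,y)^*.$$
   Context: Let $\Gamma=(V',E)$ be a connected, locally finite, loop-free undirected graph, let $V\subset V'$, and let $\delta V=\{z\in V'\setminus V:\exists x\in V,\ x\sim z\}$ be its vertex boundary, where $x\sim z$ means adjacency ($V$ and $\delta V$ may be finite or infinite, and graphs with no boundary, $\delta V=\emptyset$, are allowed). Let $d_x$ be the degree of $x$, and let $L(x,x)=d_x$, $L(x,z)=-1$ if $z\sim x$, and $L(x,z)=0$ otherwise. Fix $\alpha_0>0$ and $t\ge0$. The diffusion equation with uniform absorption, for interior source $f$ and boundary source $g$, is $\sum_z L(x,z)u(z)+\alpha_0u(x)=f(x)$ for $x\in V$, together with $t\,u(x)+\sum_{z\in V,\,z\sim x}[u(x)-u(z)]=g(x)$ for $x\in\delta V$. Let $H_0$ be the operator on functions $u$ on $V\cup\delta V$ given by the left-hand sides of these equations. The background Green's function $G_0$ is the inverse of $H_0$ (assumed to exist), with kernel $G_0(x,z)$, $x,z\in V\cup\delta V$. For a potential $\eta\ge0$ supported in $V$, the diffusion equation with absorption $\alpha_0(1+\eta)$ is obtained by replacing $\alpha_0u(x)$ with $\alpha_0[1+\eta(x)]u(x)$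 for $x\in V$. Its operator is $H=H_0+\alpha_0D_\eta$, where $D_\eta$ is multiplication by $\eta$ (zero on $\delta V$), and its Green's function is $G=H^{-1}$. The function $\delta_y$ equals $1$ at $y$ and $0$ elsewhere, $G_0(\cdot,y)$ is the column of $G_0$ indexed by $y$, and $^*$ is the conjugate transpose. *)

theory Defs
  imports "HOL-Analysis.Analysis" "Graph_Theory.Digraph_Component"
begin

text \<open>
  An undirected loop-free graph without multiple edges is a \<^locale>\<open>pair_bidirected_digraph\<close>:
  each edge between \<open>x\<close> and \<open>z\<close> is represented by the two arcs \<open>(x, z)\<close> and \<open>(z, x)\<close>, so the
  vertex degree is the out-degree.  The graph may be infinite.
\<close>

definition locally_finite :: "'a pair_pre_digraph \<Rightarrow> bool" where
  "locally_finite \<Gamma> \<longleftrightarrow> (\<forall>x \<in> pverts \<Gamma>. finite (out_arcs \<Gamma> x))"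

definition vertex_boundary :: "'a pair_pre_digraph \<Rightarrow> 'a set \<Rightarrow> 'a set" where
  "vertex_boundary \<Gamma> V = {z \<in> pverts \<Gamma> - V. \<exists>x\<in>V. x \<rightarrow>\<^bsub>\<Gamma>\<^esub> z}"

definition vertex_closure :: "'a pair_pre_digraph \<Rightarrow> 'a set \<Rightarrow> 'a set" where
  "vertex_closure \<Gamma> V = V \<union> vertex_boundary \<Gamma> V"

definition laplacian :: "'a pair_pre_digraph \<Rightarrow> 'a \<Rightarrow> 'a \<Rightarrow> real" where
  "laplacian \<Gamma> x z =
     (if z = x then real (out_degree \<Gamma> x) else if x \<rightarrow>\<^bsub>\<Gamma>\<^esub> z then - 1 else 0)"

text \<open>
  Functions on a vertex set \<open>S\<close> are functions on the ambient type that vanish outside \<open>S\<close>.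

  The diffusion operator with absorption \<open>\<alpha>\<^sub>0 (1 + \<eta>)\<close>; the background operator is the case
  \<open>\<eta> = 0\<close>.  By local finiteness both sums have only finitely many nonzero terms.
\<close>

definition diffusion_op ::
  "'a pair_pre_digraph \<Rightarrow> 'a set \<Rightarrow> real \<Rightarrow> real \<Rightarrow> ('a \<Rightarrow> real) \<Rightarrow> ('a \<Rightarrow> complex) \<Rightarrow> 'a \<Rightarrow> complex"
where
  "diffusion_op \<Gamma> V \<alpha>\<^sub>0 t \<eta> u x =
     (if x \<in> V then
        (\<Sum>\<^sub>\<infinity>z\<in>vertex_closure \<Gamma> V. of_real (laplacian \<Gamma> x z) * u z)
          + of_real (\<alpha>\<^sub>0 * (1 + \<eta> x)) * u x
      else if x \<in> vertex_boundary \<Gamma> V then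
        of_real t * u x + (\<Sum>z | z \<in> V \<and> x \<rightarrow>\<^bsub>\<Gamma>\<^esub> z. u x - u z)
      else 0)"

definition l2_on :: "'a set \<Rightarrow> ('a \<Rightarrow> complex) set" where
  "l2_on S = {u. (\<forall>x. x \<notin> S \<longrightarrow> u x = 0) \<and> (\<lambda>x. (cmod (u x))\<^sup>2) summable_on S}"

lemma l2_on_finite: "finite S \<Longrightarrow> l2_on S = {u. \<forall>x. x \<notin> S \<longrightarrow> u x = 0}"
  by (simp add: l2_on_def)

text \<open>
  On an infinite graph the diffusion operator is in general not injective on the space of all
  functions (exponentially growing solutions on the integer line, for instance), so it is taken as a possibly unbounded operator in \<open>\<ell>\<^sup>2(V \<union> \<delta>V)\<close> with its maximal domain.  When
  \<open>V \<union> \<delta>V\<close> is finite, the domain and \<open>\<ell>\<^sup>2\<close> both consist of all functions on \<open>V \<union> \<delta>V\<close>.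
\<close>

definition diffusion_dom ::
  "'a pair_pre_digraph \<Rightarrow> 'a set \<Rightarrow> real \<Rightarrow> real \<Rightarrow> ('a \<Rightarrow> real) \<Rightarrow> ('a \<Rightarrow> complex) set" where
  "diffusion_dom \<Gamma> V \<alpha>\<^sub>0 t \<eta> =
     {u \<in> l2_on (vertex_closure \<Gamma> V). diffusion_op \<Gamma> V \<alpha>\<^sub>0 t \<eta> u \<in> l2_on (vertex_closure \<Gamma> V)}"

definition has_green ::
  "'a pair_pre_digraph \<Rightarrow> 'a set \<Rightarrow> real \<Rightarrow> real \<Rightarrow> ('a \<Rightarrow> real) \<Rightarrow> bool" where
  "has_green \<Gamma> V \<alpha>\<^sub>0 t \<eta> \<longleftrightarrow>
     bij_betw (diffusion_op \<Gamma> V \<alpha>\<^sub>0 t \<eta>) (diffusion_dom \<Gamma> V \<alpha>\<^sub>0 t \<eta>) (l2_on (vertex_closure \<Gamma> V))"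

definition green ::
  "'a pair_pre_digraph \<Rightarrow> 'a set \<Rightarrow> real \<Rightarrow> real \<Rightarrow> ('a \<Rightarrow> real) \<Rightarrow> ('a \<Rightarrow> complex) \<Rightarrow> 'a \<Rightarrow> complex"
where
  "green \<Gamma> V \<alpha>\<^sub>0 t \<eta> = the_inv_into (diffusion_dom \<Gamma> V \<alpha>\<^sub>0 t \<eta>) (diffusion_op \<Gamma> V \<alpha>\<^sub>0 t \<eta>)"

definition green_kernel ::
  "'a pair_pre_digraph \<Rightarrow> 'a set \<Rightarrow> real \<Rightarrow> real \<Rightarrow> ('a \<Rightarrow> real) \<Rightarrow> 'a \<Rightarrow> 'a \<Rightarrow> complex" where
  "green_kernel \<Gamma> V \<alpha>\<^sub>0 t \<eta> x z = green \<Gamma> V \<alpha>\<^sub>0 t \<eta> (\<lambda>w. of_bool (w = z)) x"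

text \<open>The potential \<open>\<kappa> \<delta>\<^sub>y\<close>.\<close>

definition point_absorber :: "real \<Rightarrow> 'a \<Rightarrow> 'a \<Rightarrow> real" where
  "point_absorber \<kappa> y x = \<kappa> * of_bool (x = y)"

text \<open>The rank-one operator \<open>a b\<^sup>*\<close> on functions on \<open>S\<close>.\<close>

definition rank_one_on :: "'a set \<Rightarrow> ('a \<Rightarrow> complex) \<Rightarrow> ('a \<Rightarrow> complex) \<Rightarrow> ('a \<Rightarrow> complex) \<Rightarrow> 'a \<Rightarrow> complex"
where
  "rank_one_on S a b f x = a x * (\<Sum>\<^sub>\<infinity>z\<in>S. cnj (b z) * f z)"

end

theory Submission
  imports Defs
begin

text \<open>
  The perturbation has rank one, so the Sherman--Morrison formula gives \<open>G\<close> once we know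
  \<open>1 + \<alpha>\<^sub>0 \<kappa> G\<^sub>0(y, y) \<noteq> 0\<close> and \<open>(G\<^sub>0 f)(y) = \<langle>G\<^sub>0(\<sqdot>, y), f\<rangle>\<close>.  The first follows from the minimum principle,
  which makes \<open>G\<^sub>0(\<sqdot>, y)\<close> nonnegative.  The second is the symmetry of \<open>G\<^sub>0\<close>, which is not immediate
  because \<open>H\<^sub>0\<close> is unbounded with maximal domain.  For a finite set \<open>B\<close> of vertices and \<open>f \<ge> 0\<close>, the
  solutions of the Dirichlet problem on \<open>B\<close> increase with \<open>B\<close> and stay below \<open>G\<^sub>0 f\<close>; by the minimum
  principle their limit, being a solution that vanishes at infinity, is \<open>G\<^sub>0 f\<close>.  The symmetry of the finite
  Dirichlet problems thus carries over to \<open>G\<^sub>0\<close>.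
\<close>

section \<open>Functions vanishing at infinity\<close>

text \<open>Weaker than square summability, yet enough for a negative infimum to be attained, and
  inherited by every pointwise dominated function, such as the limit of Dirichlet solutions.\<close>

definition vanishes_at_infinity_on :: "'a set \<Rightarrow> ('a \<Rightarrow> 'b::real_normed_vector) \<Rightarrow> bool" where
  "vanishes_at_infinity_on S u \<longleftrightarrow> (\<forall>e>0. finite {x \<in> S. e \<le> norm (u x)})"

lemma vanishes_at_infinity_on_mono:
  assumes "vanishes_at_infinity_on S w" and "\<And>x. x \<in> S \<Longrightarrow> norm (u x) \<le> norm (w x)"
  shows "vanishes_at_infinity_on S u"
  unfolding vanishes_at_infinity_on_def
proof (intro allI impI)
  fix e :: real assume "e > 0"
  then have "finite {x \<in> S. e \<le> norm (w x)}"
    using assms(1) by (simp add: vanishes_at_infinity_on_def)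
  moreover have "{x \<in> S. e \<le> norm (u x)} \<subseteq> {x \<in> S. e \<le> norm (w x)}"
    using assms(2) order_trans by blast
  ultimately show "finite {x \<in> S. e \<le> norm (u x)}"
    by (rule rev_finite_subset)
qed

lemma vanishes_at_infinity_on_Re:
  "vanishes_at_infinity_on S u \<Longrightarrow> vanishes_at_infinity_on S (\<lambda>x. Re (u x))"
  by (erule vanishes_at_infinity_on_mono) (simp add: abs_Re_le_cmod)

lemma vanishes_at_infinity_on_Im:
  "vanishes_at_infinity_on S u \<Longrightarrow> vanishes_at_infinity_on S (\<lambda>x. Im (u x))"
  by (erule vanishes_at_infinity_on_mono) (simp add: abs_Im_le_cmod)

lemma vanishes_at_infinity_on_diff:
  assumes "vanishes_at_infinity_on S u" and "vanishes_at_infinity_on S v"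
  shows "vanishes_at_infinity_on S (\<lambda>x. u x - v x)"
  unfolding vanishes_at_infinity_on_def
proof (intro allI impI)
  fix e :: real assume "e > 0"
  then have "finite ({x \<in> S. e/2 \<le> norm (u x)} \<union> {x \<in> S. e/2 \<le> norm (v x)})"
    using assms half_gt_zero unfolding vanishes_at_infinity_on_def by blast
  moreover have "{x \<in> S. e \<le> norm (u x - v x)} \<subseteq>
      {x \<in> S. e/2 \<le> norm (u x)} \<union> {x \<in> S. e/2 \<le> norm (v x)}"
  proof
    fix x assume "x \<in> {x \<in> S. e \<le> norm (u x - v x)}"
    then show "x \<in> {x \<in> S. e/2 \<le> norm (u x)} \<union> {x \<in> S. e/2 \<le> norm (v x)}"
      using norm_triangle_ineq4[of "u x" "v x"] by auto
  qed
  ultimately show "finite {x \<in> S. e \<le> norm (u x - v x)}"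
    by (rule rev_finite_subset)
qed

lemma vanishes_at_infinity_on_finite_support:
  assumes "finite B" and "\<And>x. x \<notin> B \<Longrightarrow> u x = 0"
  shows "vanishes_at_infinity_on S u"
  unfolding vanishes_at_infinity_on_def
proof (intro allI impI)
  fix e :: real assume "e > 0"
  with assms(2) have "{x \<in> S. e \<le> norm (u x)} \<subseteq> B"
    by force
  then show "finite {x \<in> S. e \<le> norm (u x)}"
    using assms(1) by (rule finite_subset)
qed

section \<open>Matrices with finite rows acting on functions\<close>

text \<open>Summing over the nonzero entries only keeps the index set finite although
  \<open>S\<close> may be infinite. The codomain is polymorphic so that order arguments run over the
  reals and the results transfer to complex functions.\<close>

definition row_op :: "'a set \<Rightarrow> ('a \<Rightarrow> 'a \<Rightarrow> real) \<Rightarrow> ('a \<Rightarrow> 'b::real_vector) \<Rightarrow> 'a \<Rightarrow> 'b" where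
  "row_op S a u x = (\<Sum>z | z \<in> S \<and> a x z \<noteq> 0. a x z *\<^sub>R u z)"

lemma row_op_eq_sum:
  assumes "finite T" and "T \<subseteq> S" and "\<And>z. z \<in> S - T \<Longrightarrow> a x z *\<^sub>R u z = 0"
    and "finite {z \<in> S. a x z \<noteq> 0}"
  shows "row_op S a u x = (\<Sum>z\<in>T. a x z *\<^sub>R u z)"
  unfolding row_op_def using assms
  by (intro sum.mono_neutral_cong) auto

lemma row_op_add: "row_op S a (\<lambda>z. u z + v z) x = row_op S a u x + row_op S a v x"
  by (simp add: row_op_def scaleR_add_right sum.distrib)

lemma row_op_diff: "row_op S a (\<lambda>z. u z - v z) x = row_op S a u x - row_op S a v x"
  by (simp add: row_op_def scaleR_diff_right sum_subtractf)

lemma row_op_cmult: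
  fixes u :: "'a \<Rightarrow> 'b::real_algebra"
  shows "row_op S a (\<lambda>z. k * u z) x = k * row_op S a u x"
  by (simp add: row_op_def sum_distrib_left)

lemma Re_row_op: "Re (row_op S a u x) = row_op S a (\<lambda>z. Re (u z)) x"
  by (simp add: row_op_def)

lemma Im_row_op: "Im (row_op S a u x) = row_op S a (\<lambda>z. Im (u z)) x"
  by (simp add: row_op_def)

lemma row_op_of_real: "row_op S a (\<lambda>z. complex_of_real (u z)) x = of_real (row_op S a u x)"
  by (simp add: row_op_def scaleR_conv_of_real)

text \<open>
  The row sum of \<open>a\<close> at \<open>x\<close> is the absorption there.  It may be zero (boundary vertices when \<open>t = 0\<close>),
  but then a neighbour must be absorbing.
\<close>

locale killed_laplacian =
  fixes S :: "'a set" and a :: "'a \<Rightarrow> 'a \<Rightarrow> real"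
  assumes sym: "x \<in> S \<Longrightarrow> z \<in> S \<Longrightarrow> a x z = a z x"
    and finite_row: "x \<in> S \<Longrightarrow> finite {z \<in> S. a x z \<noteq> 0}"
    and offdiag: "x \<in> S \<Longrightarrow> z \<in> S \<Longrightarrow> x \<noteq> z \<Longrightarrow> a x z \<le> 0"
    and row_sum_nonneg: "x \<in> S \<Longrightarrow> 0 \<le> row_op S a (\<lambda>_. 1::real) x"
    and killed: "x \<in> S \<Longrightarrow> 0 < row_op S a (\<lambda>_. 1::real) x \<or>
      (\<exists>z\<in>S. z \<noteq> x \<and> a x z \<noteq> 0 \<and> 0 < row_op S a (\<lambda>_. 1::real) z)"
begin

section \<open>Minimum principle and uniqueness\<close>

text \<open>If \<open>m\<close> is a negative minimum of \<open>v\<close> attained at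
  \<open>x\<close>, then both summands on the right are nonpositive: the diagonal term of the sum
  vanishes and the other coefficients are nonpositive.\<close>

lemma row_op_shift:
  "row_op S a v x = (\<Sum>z | z \<in> S \<and> a x z \<noteq> 0. a x z * (v z - m)) + m * row_op S a (\<lambda>_. 1) x"
  for v :: "'a \<Rightarrow> real"
  by (simp add: row_op_def algebra_simps sum_subtractf sum_distrib_left)

text \<open>A negative value would force a negative minimum to be attained. There the supersolution
  inequality forces zero absorption and equal values at all neighbours, so the minimum spreads to an
  absorbing neighbour, which is impossible.\<close>

lemma minimum_principle:
  fixes v :: "'a \<Rightarrow> real"
  assumes super: "\<And>x. x \<in> B \<Longrightarrow> 0 \<le> row_op S a v x"
    and nonneg: "\<And>x. x \<in> S - B \<Longrightarrow> 0 \<le> v x"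
    and inf: "vanishes_at_infinity_on S v"
    and x: "x \<in> S"
  shows "0 \<le> v x"
proof (rule ccontr)
  assume "\<not> 0 \<le> v x"
  then have neg: "v x < 0" by simp
  \<comment> \<open>Every point of \<open>S\<close> outside \<open>A\<close> has a value above
    \<open>v x\<close>, so a minimum over the finite set \<open>A\<close> is a minimum over
    \<open>S\<close>. Large positive values in \<open>A\<close> do no harm.\<close>
  define A where "A = {z \<in> S. - v x \<le> norm (v z)}"
  have "finite A" "x \<in> A"
    using inf neg x by (auto simp: A_def vanishes_at_infinity_on_def)
  then obtain p where p: "p \<in> A" "\<And>z. z \<in> A \<Longrightarrow> v p \<le> v z"
    using ex_min_if_finite[of "v ` A"] by (metis (no_types, lifting) arg_min_if_finite(1) arg_min_least empty_iff)
  have pS: "p \<in> S" using p by (simp add: A_def)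
  have px: "v p \<le> v x" using p \<open>x \<in> A\<close> by blast
  have min: "v p \<le> v z" if "z \<in> S" for z
  proof (cases "z \<in> A")
    case False
    with that px show ?thesis by (auto simp: A_def)
  qed (use p in blast)
  have const: "row_op S a (\<lambda>_. 1::real) q \<le> 0 \<and> (\<forall>z\<in>S. z \<noteq> q \<and> a q z \<noteq> 0 \<longrightarrow> v z = v p)"
    if q: "q \<in> S" "v q = v p" for q
  proof -
    let ?N = "{z \<in> S. a q z \<noteq> 0}"
    have "q \<in> B" using q nonneg px neg by force
    then have 1: "0 \<le> row_op S a v q" by (rule super)
    have terms: "a q z * (v z - v p) \<le> 0" if "z \<in> S" for z
      using offdiag[OF \<open>q \<in> S\<close> that] min[OF that] q
      by (cases "z = q") (auto intro: mult_nonpos_nonneg)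
    then have 2: "(\<Sum>z\<in>?N. a q z * (v z - v p)) \<le> 0"
      by (intro sum_nonpos) auto
    have 3: "v p * row_op S a (\<lambda>_. 1) q \<le> 0"
      using row_sum_nonneg[OF q(1)] px neg by (simp add: mult_nonpos_nonneg)
    \<comment> \<open>Two nonpositive numbers have a nonnegative sum, so both are zero.\<close>
    have eq0: "v p * row_op S a (\<lambda>_. 1) q = 0" "(\<Sum>z\<in>?N. a q z * (v z - v p)) = 0"
      using 1 2 3 row_op_shift[of v q "v p"] by linarith+
    have "(\<Sum>z\<in>?N. - (a q z * (v z - v p))) = 0"
      using eq0(2) by (simp add: sum_negf)
    then have "\<forall>z\<in>?N. - (a q z * (v z - v p)) = 0"
      using terms finite_row[OF q(1)] by (subst (asm) sum_nonneg_eq_0_iff) auto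
    then show ?thesis
      using eq0(1) px neg by auto
  qed
  from killed[OF pS] const[OF pS] obtain z
    where z: "z \<in> S" "v z = v p" "0 < row_op S a (\<lambda>_. 1::real) z"
    by (metis not_less)
  with const[of z] show False by simp
qed

lemma uniqueness:
  fixes u v :: "'a \<Rightarrow> real"
  assumes "\<And>x. x \<in> S \<Longrightarrow> row_op S a u x = row_op S a v x"
    and "vanishes_at_infinity_on S u" and "vanishes_at_infinity_on S v" and "x \<in> S"
  shows "u x = v x"
proof -
  have "0 \<le> u x - v x"
    by (rule minimum_principle[of S "\<lambda>x. u x - v x"])
      (use assms vanishes_at_infinity_on_diff[of S u v] in \<open>simp_all add: row_op_diff\<close>)
  moreover have "0 \<le> v x - u x"
    by (rule minimum_principle[of S "\<lambda>x. v x - u x"])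
      (use assms vanishes_at_infinity_on_diff[of S v u] in \<open>simp_all add: row_op_diff\<close>)
  ultimately show ?thesis by simp
qed

section \<open>Finite Dirichlet problems and their limit\<close>

text \<open>
  Adjoining a vertex \<open>b\<close> to \<open>B\<close>: the solution on \<open>B\<close> is corrected by a multiple of a function \<open>q\<close> that is
  harmonic on \<open>B\<close> with \<open>q b = 1\<close>.
\<close>

lemma finite_dirichlet_problem:
  fixes f :: "'a \<Rightarrow> real"
  assumes "finite B" and "B \<subseteq> S"
  shows "\<exists>u. (\<forall>x. x \<notin> B \<longrightarrow> u x = 0) \<and> (\<forall>x\<in>B. row_op S a u x = f x)"
  using assms
proof (induction B arbitrary: f rule: finite_induct)
  case (insert b B)
  define \<delta> where "\<delta> = (\<lambda>x. of_bool (x = b) :: real)"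
  obtain p where p: "\<forall>x. x \<notin> B \<longrightarrow> p x = 0" "\<forall>x\<in>B. row_op S a p x = - row_op S a \<delta> x"
    using insert.IH[of "\<lambda>x. - row_op S a \<delta> x"] insert.prems by auto
  obtain w where w: "\<forall>x. x \<notin> B \<longrightarrow> w x = 0" "\<forall>x\<in>B. row_op S a w x = f x"
    using insert.IH[of f] insert.prems by auto
  define q where "q = (\<lambda>x. \<delta> x + p x)"
  have q: "q b = 1" "\<And>x. x \<notin> insert b B \<Longrightarrow> q x = 0" "\<And>x. x \<in> B \<Longrightarrow> row_op S a q x = 0"
    using p insert.hyps by (auto simp: q_def \<delta>_def row_op_add)
  have q_inf: "vanishes_at_infinity_on S q" "vanishes_at_infinity_on S (\<lambda>x. - q x)"
    using q(2) insert.hyps(1)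
    by (intro vanishes_at_infinity_on_finite_support[of "insert b B"]; simp)+
  \<comment> \<open>Otherwise \<open>q\<close> would be harmonic on all of \<open>insert b B\<close>
    with zero values outside, and the minimum principle for \<open>- q\<close> would contradict
    \<open>q b = 1\<close>.\<close>
  have nz: "row_op S a q b \<noteq> 0"
  proof
    assume 0: "row_op S a q b = 0"
    have neg: "row_op S a (\<lambda>x. - q x) x = - row_op S a q x" for x
      using row_op_cmult[of S a "-1" q x] by simp
    have "0 \<le> - q b"
      by (rule minimum_principle[of "insert b B" "\<lambda>x. - q x" b])
        (use 0 q q_inf(2) neg insert.prems in auto)
    then show False using q(1) by simp
  qed
  \<comment> \<open>The multiple of \<open>q\<close> that cancels the residual of \<open>w\<close>
    at \<open>b\<close>; on \<open>B\<close> nothing changes since \<open>q\<close> is harmonic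
    there.\<close>
  define s where "s = (f b - row_op S a w b) / row_op S a q b"
  have "row_op S a (\<lambda>x. w x + s * q x) x = row_op S a w x + s * row_op S a q x" for x
    by (simp add: row_op_add row_op_cmult)
  then have "row_op S a (\<lambda>x. w x + s * q x) x = f x" if "x \<in> insert b B" for x
    using that w q(3) nz by (auto simp: s_def)
  moreover have "w x + s * q x = 0" if "x \<notin> insert b B" for x
    using that w q(2) by auto
  ultimately show ?case
    by (intro exI[of _ "\<lambda>x. w x + s * q x"] conjI allI impI ballI)
qed auto

definition dirichlet :: "'a set \<Rightarrow> ('a \<Rightarrow> real) \<Rightarrow> 'a \<Rightarrow> real" where
  "dirichlet B f = (SOME u. (\<forall>x. x \<notin> B \<longrightarrow> u x = 0) \<and> (\<forall>x\<in>B. row_op S a u x = f x))"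

lemma
  assumes "finite B" and "B \<subseteq> S"
  shows dirichlet_outside: "x \<notin> B \<Longrightarrow> dirichlet B f x = 0"
    and row_op_dirichlet: "x \<in> B \<Longrightarrow> row_op S a (dirichlet B f) x = f x"
  using someI_ex[OF finite_dirichlet_problem[OF assms, of f]] by (auto simp: dirichlet_def)

lemma vanishes_dirichlet:
  assumes "finite B" and "B \<subseteq> S"
  shows "vanishes_at_infinity_on S (dirichlet B f)"
  using assms by (intro vanishes_at_infinity_on_finite_support[of B]) (simp_all add: dirichlet_outside)

lemma dirichlet_nonneg:
  assumes "finite B" and "B \<subseteq> S" and "\<And>x. x \<in> B \<Longrightarrow> 0 \<le> f x" and "x \<in> S"
  shows "0 \<le> dirichlet B f x"
  by (rule minimum_principle[of B])
    (use assms in \<open>auto simp: row_op_dirichlet dirichlet_outside vanishes_dirichlet\<close>)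

text \<open>The difference is a supersolution on \<open>B\<close> and equals \<open>w\<close> off
  \<open>B\<close>, so the minimum principle applies. Taking the solution on a larger set as
  \<open>w\<close> yields monotonicity in the domain.\<close>

lemma dirichlet_le:
  assumes "finite B" and "B \<subseteq> S" and "\<And>x. x \<in> B \<Longrightarrow> f x \<le> row_op S a w x"
    and "\<And>x. x \<in> S \<Longrightarrow> 0 \<le> w x" and "vanishes_at_infinity_on S w" and "x \<in> S"
  shows "dirichlet B f x \<le> w x"
proof -
  have "0 \<le> w x - dirichlet B f x"
    by (rule minimum_principle[of B "\<lambda>x. w x - dirichlet B f x"])
      (use assms vanishes_at_infinity_on_diff[of S w "dirichlet B f"] vanishes_dirichlet[of B f] in
        \<open>simp_all add: row_op_diff row_op_dirichlet dirichlet_outside\<close>)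
  then show ?thesis by simp
qed

lemma dirichlet_mono:
  assumes "finite C" and "C \<subseteq> S" and "B \<subseteq> C" and "\<And>x. x \<in> C \<Longrightarrow> 0 \<le> f x" and "x \<in> S"
  shows "dirichlet B f x \<le> dirichlet C f x"
  by (rule dirichlet_le)
    (use assms in \<open>auto intro: finite_subset simp: row_op_dirichlet subset_iff dirichlet_nonneg vanishes_dirichlet\<close>)

text \<open>The Dirichlet solutions increase with \<open>B\<close> and are bounded by
  \<open>w\<close>, hence converge to their supremum \<open>s\<close>. Finite rows let the equation
  pass to the limit, \<open>s\<close> vanishes at infinity because it lies between 0 and
  \<open>w\<close>, and uniqueness identifies it with \<open>w\<close>.\<close>

lemma dirichlet_tendsto:
  assumes f: "\<And>x. x \<in> S \<Longrightarrow> 0 \<le> f x"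
    and w: "\<And>x. x \<in> S \<Longrightarrow> row_op S a w x = f x" "vanishes_at_infinity_on S w"
    and x: "x \<in> S"
  shows "((\<lambda>B. dirichlet B f x) \<longlongrightarrow> w x) (finite_subsets_at_top S)"
proof -
  let ?F = "{B. finite B \<and> B \<subseteq> S}"
  define s where "s x = (SUP B\<in>?F. dirichlet B f x)" for x
  have w_nonneg: "0 \<le> w x" if "x \<in> S" for x
    by (rule minimum_principle[of S w]) (use that w f in auto)
  have le_w: "dirichlet B f x \<le> w x" if "B \<in> ?F" "x \<in> S" for B x
    by (rule dirichlet_le) (use that w w_nonneg in auto)
  then have bdd: "bdd_above ((\<lambda>B. dirichlet B f x) ` ?F)" if "x \<in> S" for x
    using that by (auto intro!: bdd_aboveI2)
  have le_s: "dirichlet B f x \<le> s x" if "B \<in> ?F" "x \<in> S" for B x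
    unfolding s_def using that bdd by (intro cSUP_upper) auto
  have lim: "((\<lambda>B. dirichlet B f x) \<longlongrightarrow> s x) (finite_subsets_at_top S)" if x: "x \<in> S" for x
  proof (rule order_tendstoI)
    fix l assume "l < s x"
    moreover have "{} \<in> ?F" by simp
    ultimately obtain B where B: "B \<in> ?F" "l < dirichlet B f x"
      unfolding s_def using bdd[OF x] by (subst (asm) less_cSUP_iff) auto
    have "l < dirichlet C f x" if "finite C" "B \<subseteq> C" "C \<subseteq> S" for C
      using B(2) dirichlet_mono[of C B f x] that f x by fastforce
    then show "\<forall>\<^sub>F C in finite_subsets_at_top S. l < dirichlet C f x"
      using B(1) unfolding eventually_finite_subsets_at_top by blast
  next
    fix l assume "s x < l"
    then show "\<forall>\<^sub>F C in finite_subsets_at_top S. dirichlet C f x < l"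
      using le_s x by (intro eventually_finite_subsets_at_top_weakI) fastforce
  qed
  have "row_op S a s z = f z" if z: "z \<in> S" for z
  proof -
    have "((\<lambda>B. row_op S a (dirichlet B f) z) \<longlongrightarrow> row_op S a s z) (finite_subsets_at_top S)"
      unfolding row_op_def by (intro tendsto_intros lim) auto
    \<comment> \<open>The equation at \<open>z\<close> holds as soon as \<open>B\<close> contains
      \<open>z\<close>.\<close>
    moreover have "\<forall>\<^sub>F B in finite_subsets_at_top S. f z = row_op S a (dirichlet B f) z"
      unfolding eventually_finite_subsets_at_top
      using z by (intro exI[of _ "{z}"]) (auto simp: row_op_dirichlet)
    then have "((\<lambda>B. row_op S a (dirichlet B f) z) \<longlongrightarrow> f z) (finite_subsets_at_top S)"
      by (rule Lim_transform_eventually[OF tendsto_const])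
    ultimately show ?thesis
      using tendsto_unique finite_subsets_at_top_neq_bot by blast
  qed
  moreover have "vanishes_at_infinity_on S s"
  proof (rule vanishes_at_infinity_on_mono[OF w(2)])
    fix z assume z: "z \<in> S"
    have "s z \<le> w z"
      unfolding s_def using le_w z by (intro cSUP_least) auto
    \<comment> \<open>The solution on the empty set is zero, which gives the lower bound.\<close>
    moreover have "0 \<le> s z"
      using le_s[of "{}" z] z dirichlet_outside[of "{}" z f] by simp
    ultimately show "norm (s z) \<le> norm (w z)" by simp
  qed
  ultimately have "s x = w x"
    using w x uniqueness[of s w x] by simp
  with lim[OF x] show ?thesis by simp
qed

section \<open>Symmetry and reciprocity\<close>

text \<open>Both functions are supported in \<open>B\<close>, so only the finite symmetric block of
  \<open>a\<close> over \<open>B\<close> enters and the double sum can be exchanged.\<close>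

lemma row_op_symmetric:
  fixes u v :: "'a \<Rightarrow> real"
  assumes B: "finite B" "B \<subseteq> S" and u: "\<And>x. x \<notin> B \<Longrightarrow> u x = 0" and v: "\<And>x. x \<notin> B \<Longrightarrow> v x = 0"
  shows "(\<Sum>x\<in>B. u x * row_op S a v x) = (\<Sum>x\<in>B. row_op S a u x * v x)"
proof -
  have eq: "row_op S a w x = (\<Sum>z\<in>B. a x z * w z)" if "x \<in> B" "\<And>x. x \<notin> B \<Longrightarrow> w x = 0"
    for w :: "'a \<Rightarrow> real" and x
    using row_op_eq_sum[of B S a x w] that B finite_row by auto
  have "(\<Sum>x\<in>B. u x * row_op S a v x) = (\<Sum>x\<in>B. \<Sum>z\<in>B. u x * (a x z * v z))"
    using v by (simp add: eq sum_distrib_left)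
  also have "\<dots> = (\<Sum>z\<in>B. \<Sum>x\<in>B. u x * (a x z * v z))"
    by (rule sum.swap)
  also have "\<dots> = (\<Sum>z\<in>B. \<Sum>x\<in>B. a z x * u x * v z)"
    using B sym by (intro sum.cong refl) (auto simp: subset_iff)
  also have "\<dots> = (\<Sum>z\<in>B. row_op S a u z * v z)"
    using u by (simp add: eq sum_distrib_right)
  finally show ?thesis .
qed

text \<open>Symmetry of the Green's function for nonnegative sources. The partial sums of the
  pairing are squeezed between \<open>dirichlet B f y\<close> and its limit \<open>w y\<close>, so
  convergence of the infinite sum comes out as well.\<close>

lemma green_reciprocity:
  fixes u w f :: "'a \<Rightarrow> real"
  assumes y: "y \<in> S" and f: "\<And>x. x \<in> S \<Longrightarrow> 0 \<le> f x"
    and u: "\<And>x. x \<in> S \<Longrightarrow> row_op S a u x = of_bool (x = y)" "vanishes_at_infinity_on S u"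
    and w: "\<And>x. x \<in> S \<Longrightarrow> row_op S a w x = f x" "vanishes_at_infinity_on S w"
  shows "((\<lambda>x. u x * f x) has_sum w y) S"
proof -
  let ?\<delta> = "\<lambda>x. of_bool (x = y) :: real"
  have u_nonneg: "0 \<le> u x" if "x \<in> S" for x
    by (rule minimum_principle[of S u]) (use that u in auto)
  have w_nonneg: "0 \<le> w x" if "x \<in> S" for x
    by (rule minimum_principle[of S w]) (use that w f in auto)
  have pair: "(\<Sum>x\<in>B. dirichlet B ?\<delta> x * f x) = dirichlet B f y"
    if B: "finite B" "B \<subseteq> S" "y \<in> B" for B
  proof -
    have "(\<Sum>x\<in>B. dirichlet B ?\<delta> x * f x) =
        (\<Sum>x\<in>B. dirichlet B ?\<delta> x * row_op S a (dirichlet B f) x)"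
      using B by (simp add: row_op_dirichlet)
    also have "\<dots> = (\<Sum>x\<in>B. row_op S a (dirichlet B ?\<delta>) x * dirichlet B f x)"
      using B by (intro row_op_symmetric) (auto simp: dirichlet_outside)
    also have "\<dots> = dirichlet B f y"
      using B by (simp add: row_op_dirichlet of_bool_def if_distrib[of "\<lambda>c. c * _"] cong: if_cong)
    finally show ?thesis .
  qed
  have d_le: "dirichlet B ?\<delta> x \<le> u x" "dirichlet B f x \<le> w x" if "finite B" "B \<subseteq> S" "x \<in> S" for B x
    by (rule dirichlet_le; use that f u w u_nonneg w_nonneg in auto)+
  \<comment> \<open>Keeping \<open>A\<close> fixed while \<open>B\<close> grows separates the two
    limits: the terms are nonnegative, so the sum over \<open>A\<close> is at most the one over
    \<open>B\<close>, which symmetry turns into \<open>dirichlet B f y\<close>.\<close>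
  have partial_le: "(\<Sum>x\<in>A. u x * f x) \<le> w y" if A: "finite A" "A \<subseteq> S" for A
  proof (rule tendsto_upperbound)
    show "((\<lambda>B. \<Sum>x\<in>A. dirichlet B ?\<delta> x * f x) \<longlongrightarrow> (\<Sum>x\<in>A. u x * f x)) (finite_subsets_at_top S)"
      using A u by (intro tendsto_intros dirichlet_tendsto) auto
    have "(\<Sum>x\<in>A. dirichlet B ?\<delta> x * f x) \<le> w y"
      if B: "finite B" "insert y A \<subseteq> B" "B \<subseteq> S" for B
    proof -
      have "(\<Sum>x\<in>A. dirichlet B ?\<delta> x * f x) \<le> (\<Sum>x\<in>B. dirichlet B ?\<delta> x * f x)"
        using B f by (intro sum_mono2) (auto intro!: mult_nonneg_nonneg dirichlet_nonneg)
      also have "\<dots> = dirichlet B f y" using B by (intro pair) auto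
      also have "\<dots> \<le> w y" using B y by (intro d_le) auto
      finally show ?thesis .
    qed
    then show "\<forall>\<^sub>F B in finite_subsets_at_top S. (\<Sum>x\<in>A. dirichlet B ?\<delta> x * f x) \<le> w y"
      unfolding eventually_finite_subsets_at_top
      using A y by (intro exI[of _ "insert y A"]) auto
  qed simp
  show ?thesis
    unfolding has_sum_def
  proof (rule tendsto_sandwich)
    show "((\<lambda>B. dirichlet B f y) \<longlongrightarrow> w y) (finite_subsets_at_top S)"
      using y f w by (intro dirichlet_tendsto) auto
    show "((\<lambda>_. w y) \<longlongrightarrow> w y) (finite_subsets_at_top S)" by simp
    show "\<forall>\<^sub>F B in finite_subsets_at_top S. (\<Sum>x\<in>B. u x * f x) \<le> w y"
      using partial_le by (intro eventually_finite_subsets_at_top_weakI)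
    have "dirichlet B f y \<le> (\<Sum>x\<in>B. u x * f x)" if "finite B" "y \<in> B" "B \<subseteq> S" for B
      using that f d_le by (subst pair[symmetric]) (auto intro!: sum_mono mult_right_mono)
    then show "\<forall>\<^sub>F B in finite_subsets_at_top S. dirichlet B f y \<le> (\<Sum>x\<in>B. u x * f x)"
      unfolding eventually_finite_subsets_at_top
      using y by (intro exI[of _ "{y}"]) auto
  qed
qed

section \<open>Complex-valued solutions\<close>

lemma complex_uniqueness:
  fixes u v :: "'a \<Rightarrow> complex"
  assumes eq: "\<And>x. x \<in> S \<Longrightarrow> row_op S a u x = row_op S a v x"
    and u: "vanishes_at_infinity_on S u" and v: "vanishes_at_infinity_on S v" and x: "x \<in> S"
  shows "u x = v x"
proof (rule complex_eqI)
  show "Re (u x) = Re (v x)"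
  proof (rule uniqueness[of "\<lambda>x. Re (u x)" "\<lambda>x. Re (v x)"])
    show "row_op S a (\<lambda>x. Re (u x)) z = row_op S a (\<lambda>x. Re (v x)) z" if "z \<in> S" for z
      unfolding Re_row_op[symmetric] by (simp only: eq[OF that])
  qed (use u v x vanishes_at_infinity_on_Re in auto)
  show "Im (u x) = Im (v x)"
  proof (rule uniqueness[of "\<lambda>x. Im (u x)" "\<lambda>x. Im (v x)"])
    show "row_op S a (\<lambda>x. Im (u x)) z = row_op S a (\<lambda>x. Im (v x)) z" if "z \<in> S" for z
      unfolding Im_row_op[symmetric] by (simp only: eq[OF that])
  qed (use u v x vanishes_at_infinity_on_Im in auto)
qed

text \<open>Matrix and source are real, so the real part of \<open>u\<close> solves the same
  problem; uniqueness then shows that \<open>u\<close> is real.\<close>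

lemma green_nonneg:
  fixes u :: "'a \<Rightarrow> complex"
  assumes u: "\<And>x. x \<in> S \<Longrightarrow> row_op S a u x = of_bool (x = y)" "vanishes_at_infinity_on S u"
    and x: "x \<in> S"
  shows "0 \<le> Re (u x)" and "u x = of_real (Re (u x))"
proof -
  have L: "row_op S a (\<lambda>x. Re (u x)) z = of_bool (z = y)" if "z \<in> S" for z
    unfolding Re_row_op[symmetric] by (simp add: u(1)[OF that])
  have R: "vanishes_at_infinity_on S (\<lambda>x. Re (u x))"
    using u(2) by (rule vanishes_at_infinity_on_Re)
  show "0 \<le> Re (u x)"
    by (rule minimum_principle[of S "\<lambda>x. Re (u x)"]) (use L R x in auto)
  have "vanishes_at_infinity_on S (\<lambda>x. complex_of_real (Re (u x)))"
    using R by (rule vanishes_at_infinity_on_mono) simp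
  moreover have "row_op S a u z = row_op S a (\<lambda>x. complex_of_real (Re (u x))) z" if "z \<in> S" for z
    using u(1)[OF that] L[OF that] by (simp only: row_op_of_real) simp
  ultimately show "u x = of_real (Re (u x))"
    using complex_uniqueness[of u "\<lambda>x. of_real (Re (u x))" x] u(2) x by blast
qed

text \<open>Real and imaginary parts of \<open>f\<close> are split into positive and negative parts.
  Each is bounded by the modulus of \<open>f\<close>, and \<open>solvable\<close> supplies the
  solution that the nonnegative case requires.\<close>

lemma complex_green_reciprocity:
  fixes u w f :: "'a \<Rightarrow> complex"
  assumes y: "y \<in> S"
    and u: "\<And>x. x \<in> S \<Longrightarrow> row_op S a u x = of_bool (x = y)" "vanishes_at_infinity_on S u"
    and w: "\<And>x. x \<in> S \<Longrightarrow> row_op S a w x = f x" "vanishes_at_infinity_on S w"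
    and solvable: "\<And>g. (\<And>x. x \<in> S \<Longrightarrow> 0 \<le> g x \<and> g x \<le> norm (f x)) \<Longrightarrow>
      \<exists>v. (\<forall>x\<in>S. row_op S a v x = (g x :: real)) \<and> vanishes_at_infinity_on S v"
  shows "((\<lambda>x. cnj (u x) * f x) has_sum w y) S"
proof -
  have L: "row_op S a (\<lambda>x. Re (u x)) x = of_bool (x = y)" if "x \<in> S" for x
    unfolding Re_row_op[symmetric] by (simp add: u(1)[OF that])
  have R: "vanishes_at_infinity_on S (\<lambda>x. Re (u x))"
    using u(2) by (rule vanishes_at_infinity_on_Re)
  have real_part: "\<exists>v. (\<forall>x\<in>S. row_op S a v x = h x) \<and> vanishes_at_infinity_on S v
      \<and> ((\<lambda>x. Re (u x) * h x) has_sum v y) S"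
    if h: "\<And>x. x \<in> S \<Longrightarrow> \<bar>h x\<bar> \<le> norm (f x)" for h :: "'a \<Rightarrow> real"
  proof -
    obtain p where p: "\<And>x. x \<in> S \<Longrightarrow> row_op S a p x = max 0 (h x)" "vanishes_at_infinity_on S p"
      using solvable[of "\<lambda>x. max 0 (h x)"] h by fastforce
    obtain n where n: "\<And>x. x \<in> S \<Longrightarrow> row_op S a n x = max 0 (- h x)" "vanishes_at_infinity_on S n"
      using solvable[of "\<lambda>x. max 0 (- h x)"] h by fastforce
    have sp: "((\<lambda>x. Re (u x) * max 0 (h x)) has_sum p y) S"
      by (rule green_reciprocity[OF y _ L R p]) auto
    have sn: "((\<lambda>x. Re (u x) * max 0 (- h x)) has_sum n y) S"
      by (rule green_reciprocity[OF y _ L R n]) auto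
    have "((\<lambda>x. Re (u x) * max 0 (h x) - Re (u x) * max 0 (- h x)) has_sum (p y - n y)) S"
      using has_sum_add[OF sp has_sum_cmult_right[OF sn, of "- 1"]] by simp
    moreover have "Re (u x) * max 0 (h x) - Re (u x) * max 0 (- h x) = Re (u x) * h x" for x
      by (auto simp: max_def)
    ultimately have "((\<lambda>x. Re (u x) * h x) has_sum (p y - n y)) S"
      by simp
    moreover have "row_op S a (\<lambda>x. p x - n x) x = h x" if "x \<in> S" for x
      using p(1)[OF that] n(1)[OF that] by (auto simp: row_op_diff max_def)
    moreover have "vanishes_at_infinity_on S (\<lambda>x. p x - n x)"
      by (rule vanishes_at_infinity_on_diff[OF p(2) n(2)])
    ultimately show ?thesis by blast
  qed
  obtain v1 where v1: "\<And>x. x \<in> S \<Longrightarrow> row_op S a v1 x = Re (f x)" "vanishes_at_infinity_on S v1"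
      "((\<lambda>x. Re (u x) * Re (f x)) has_sum v1 y) S"
    using real_part[of "\<lambda>x. Re (f x)"] abs_Re_le_cmod by blast
  obtain v2 where v2: "\<And>x. x \<in> S \<Longrightarrow> row_op S a v2 x = Im (f x)" "vanishes_at_infinity_on S v2"
      "((\<lambda>x. Re (u x) * Im (f x)) has_sum v2 y) S"
    using real_part[of "\<lambda>x. Im (f x)"] abs_Im_le_cmod by blast
  have "Re (w y) = v1 y"
  proof (rule uniqueness[of "\<lambda>x. Re (w x)" v1])
    show "row_op S a (\<lambda>x. Re (w x)) z = row_op S a v1 z" if "z \<in> S" for z
      unfolding Re_row_op[symmetric] using w(1)[OF that] v1(1)[OF that] by simp
  qed (use v1 w y vanishes_at_infinity_on_Re in auto)
  moreover have "Im (w y) = v2 y"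
  proof (rule uniqueness[of "\<lambda>x. Im (w x)" v2])
    show "row_op S a (\<lambda>x. Im (w x)) z = row_op S a v2 z" if "z \<in> S" for z
      unfolding Im_row_op[symmetric] using w(1)[OF that] v2(1)[OF that] by simp
  qed (use v2 w y vanishes_at_infinity_on_Im in auto)
  ultimately have w_eq: "w y = of_real (v1 y) + \<i> * of_real (v2 y)"
    by (simp add: complex_eq_iff)
  have "((\<lambda>x. of_real (Re (u x) * Re (f x)) + \<i> * of_real (Re (u x) * Im (f x))) has_sum w y) S"
    unfolding w_eq by (intro has_sum_add has_sum_cmult_right has_sum_of_real v1 v2)
  moreover have "of_real (Re (u x) * Re (f x)) + \<i> * of_real (Re (u x) * Im (f x)) = cnj (u x) * f x"
    if x: "x \<in> S" for x
  proof -
    \<comment> \<open>Since \<open>u\<close> is real, the conjugation has no effect.\<close>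
    have "u x = of_real (Re (u x))"
      by (rule green_nonneg(2)[where y = y]) (use u x in auto)
    then have "Im (u x) = 0" by (metis Im_complex_of_real)
    then show ?thesis by (simp add: complex_eq_iff)
  qed
  ultimately show ?thesis
    by (subst has_sum_cong[symmetric]) auto
qed

end

section \<open>Square-summable functions\<close>

lemma l2_onD:
  assumes "u \<in> l2_on S"
  shows "x \<notin> S \<Longrightarrow> u x = 0" and "(\<lambda>x. (cmod (u x))\<^sup>2) summable_on S"
  using assms by (auto simp: l2_on_def)

lemma l2_on_dominated:
  assumes "u \<in> l2_on S" and "\<And>x. x \<notin> S \<Longrightarrow> v x = 0" and "\<And>x. x \<in> S \<Longrightarrow> cmod (v x) \<le> cmod (u x)"
  shows "v \<in> l2_on S"
  using assms summable_on_comparison_test[of "\<lambda>x. (cmod (u x))\<^sup>2" S "\<lambda>x. (cmod (v x))\<^sup>2"]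
  by (simp add: l2_on_def power_mono)

lemma l2_on_add_cmult:
  assumes "u \<in> l2_on S" and "v \<in> l2_on S"
  shows "(\<lambda>x. u x + k * v x) \<in> l2_on S"
proof -
  \<comment> \<open>Majorant from the inequality (p + q)^2 <= 2 p^2 + 2 q^2.\<close>
  have "(\<lambda>x. 2 * (cmod (u x))\<^sup>2 + 2 * (cmod k)\<^sup>2 * (cmod (v x))\<^sup>2) summable_on S"
    using assms by (intro summable_on_add summable_on_cmult_right) (auto dest: l2_onD)
  moreover have "(cmod (u x + k * v x))\<^sup>2 \<le> 2 * (cmod (u x))\<^sup>2 + 2 * (cmod k)\<^sup>2 * (cmod (v x))\<^sup>2" for x
  proof -
    have "(cmod (u x + k * v x))\<^sup>2 \<le> (cmod (u x) + cmod k * cmod (v x))\<^sup>2"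
      using norm_triangle_ineq[of "u x" "k * v x"] by (intro power_mono) (auto simp: norm_mult)
    also have "\<dots> \<le> 2 * (cmod (u x))\<^sup>2 + 2 * (cmod k * cmod (v x))\<^sup>2"
      using sum_squares_bound[of "cmod (u x)" "cmod k * cmod (v x)"] by (simp add: power2_sum)
    finally show ?thesis by (simp add: power_mult_distrib)
  qed
  ultimately have "(\<lambda>x. (cmod (u x + k * v x))\<^sup>2) summable_on S"
    using summable_on_comparison_test by fastforce
  with assms show ?thesis
    by (simp add: l2_on_def)
qed

lemma l2_on_of_bool:
  assumes "y \<in> S"
  shows "(\<lambda>x. k * of_bool (x = y)) \<in> l2_on S"
proof -
  have "(\<lambda>x. (cmod (k * of_bool (x = y)))\<^sup>2) summable_on S \<longleftrightarrow>
      (\<lambda>x. (cmod (k * of_bool (x = y)))\<^sup>2) summable_on {y}"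
    using assms by (intro summable_on_cong_neutral) auto
  then show ?thesis
    using assms by (auto simp: l2_on_def)
qed

text \<open>Chebyshev's argument: among infinitely many points with modulus at least
  \<open>e\<close>, enough can be chosen to exceed the total square sum.\<close>

lemma l2_on_vanishes_at_infinity:
  assumes "u \<in> l2_on S"
  shows "vanishes_at_infinity_on S u"
  unfolding vanishes_at_infinity_on_def
proof (intro allI impI, rule ccontr)
  fix e :: real
  assume e: "e > 0" and "infinite {x \<in> S. e \<le> norm (u x)}"
  define M where "M = infsum (\<lambda>x. (cmod (u x))\<^sup>2) S"
  obtain n :: nat where n: "M < real n * e\<^sup>2"
    using e ex_less_of_nat_mult[of "e\<^sup>2" M] by auto
  obtain F where F: "finite F" "card F = n" "F \<subseteq> {x \<in> S. e \<le> norm (u x)}"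
    using infinite_arbitrarily_large[OF \<open>infinite _\<close>] by blast
  have "real n * e\<^sup>2 = (\<Sum>x\<in>F. e\<^sup>2)"
    using F by simp
  also have "\<dots> \<le> (\<Sum>x\<in>F. (cmod (u x))\<^sup>2)"
    using F e by (intro sum_mono power_mono) auto
  also have "\<dots> \<le> M"
    unfolding M_def using F by (intro finite_sum_le_infsum l2_onD(2)[OF assms]) auto
  finally show False using n by simp
qed

section \<open>The diffusion operator as a killed Laplacian\<close>

text \<open>Edges joining two boundary vertices get no entry, because the boundary condition sums
  over neighbours in \<open>V\<close> only. This makes the matrix symmetric with the absorption as
  its row sums.\<close>

definition diffusion_matrix :: "'a pair_pre_digraph \<Rightarrow> 'a set \<Rightarrow> real \<Rightarrow> real \<Rightarrow> 'a \<Rightarrow> 'a \<Rightarrow> real" where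
  "diffusion_matrix \<Gamma> V \<alpha> t x z =
     (if x = z then
        (if x \<in> V then real (out_degree \<Gamma> x) + \<alpha> else t + real (card {w \<in> V. x \<rightarrow>\<^bsub>\<Gamma>\<^esub> w}))
      else if (x \<in> V \<or> z \<in> V) \<and> x \<rightarrow>\<^bsub>\<Gamma>\<^esub> z then - 1
      else 0)"

locale absorbing_graph =
  fixes \<Gamma> :: "'a pair_pre_digraph" and V :: "'a set" and \<alpha> t :: real
  assumes graph: "pair_bidirected_digraph \<Gamma>"
    and locfin: "locally_finite \<Gamma>"
    and V: "V \<subseteq> pverts \<Gamma>"
    and \<alpha>: "\<alpha> > 0"
    and t: "t \<ge> 0"
begin

abbreviation S :: "'a set" where "S \<equiv> vertex_closure \<Gamma> V"

abbreviation a :: "'a \<Rightarrow> 'a \<Rightarrow> real" where "a \<equiv> diffusion_matrix \<Gamma> V \<alpha> t"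

abbreviation N :: "'a \<Rightarrow> 'a set" where "N x \<equiv> {z. (x, z) \<in> parcs \<Gamma>}"

lemma adj_sym: "(x, z) \<in> parcs \<Gamma> \<Longrightarrow> (z, x) \<in> parcs \<Gamma>"
  using graph pair_sym_digraph.pair_sym_arcs[of \<Gamma>]
  by (auto simp: pair_bidirected_digraph_def symmetric_def dest: symD)

lemma adj_irrefl: "(x, x) \<notin> parcs \<Gamma>"
  using graph pair_loopfree_digraph.pair_no_loops[of \<Gamma> "(x, x)"]
  by (auto simp: pair_bidirected_digraph_def)

lemma adj_verts: "(x, z) \<in> parcs \<Gamma> \<Longrightarrow> z \<in> pverts \<Gamma>"
  using graph pair_wf_digraph.in_arcsD2[of \<Gamma> x z]
  by (auto simp: pair_bidirected_digraph_def pair_sym_digraph_def)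

lemma S_subset: "S \<subseteq> pverts \<Gamma>"
  using V by (auto simp: vertex_closure_def vertex_boundary_def)

lemma V_subset_S: "V \<subseteq> S"
  by (auto simp: vertex_closure_def)

lemma N_subset_S: "x \<in> V \<Longrightarrow> N x \<subseteq> S"
  by (auto simp: vertex_closure_def vertex_boundary_def dest: adj_verts)

lemma out_arcs_eq: "out_arcs \<Gamma> x = Pair x ` N x"
  by (auto simp: out_arcs_def)

lemma finite_N: "x \<in> S \<Longrightarrow> finite (N x)"
  using locfin S_subset by (auto simp: locally_finite_def out_arcs_eq subset_iff finite_image_iff inj_on_def)

lemma out_degree_eq: "out_degree \<Gamma> x = card (N x)"
  by (simp add: out_degree_def out_arcs_eq card_image inj_on_def)

lemma boundary_neighbour: "x \<in> S \<Longrightarrow> x \<notin> V \<Longrightarrow> \<exists>z\<in>V. (x, z) \<in> parcs \<Gamma>"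
  by (auto simp: vertex_closure_def vertex_boundary_def dest: adj_sym)

lemma finite_row: "x \<in> S \<Longrightarrow> finite {z \<in> S. a x z \<noteq> 0}"
  by (rule finite_subset[of _ "insert x (N x)"])
    (auto simp: finite_N diffusion_matrix_def split: if_splits)

lemma row_op_interior:
  assumes x: "x \<in> V"
  shows "row_op S a u x = (real (card (N x)) + \<alpha>) *\<^sub>R u x - (\<Sum>z\<in>N x. u z)"
proof -
  have S: "x \<in> S" using x V_subset_S by blast
  have "row_op S a u x = (\<Sum>z\<in>insert x (N x). a x z *\<^sub>R u z)"
    using finite_N[OF S] finite_row[OF S] N_subset_S[OF x] S
    by (intro row_op_eq_sum) (auto simp: diffusion_matrix_def)
  also have "\<dots> = (real (card (N x)) + \<alpha>) *\<^sub>R u x + (\<Sum>z\<in>N x. - u z)"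
    using finite_N[OF S] x adj_irrefl
    by (auto simp: diffusion_matrix_def out_degree_eq intro!: sum.cong)
  finally show ?thesis by (simp add: sum_negf)
qed

lemma row_op_boundary:
  assumes x: "x \<in> S" "x \<notin> V"
  shows "row_op S a u x = t *\<^sub>R u x + (\<Sum>z | z \<in> V \<and> (x, z) \<in> parcs \<Gamma>. u x - u z)"
proof -
  let ?M = "{z. z \<in> V \<and> (x, z) \<in> parcs \<Gamma>}"
  have fin: "finite ?M"
    by (rule finite_subset[OF _ finite_N[OF x(1)]]) auto
  have "row_op S a u x = (\<Sum>z\<in>insert x ?M. a x z *\<^sub>R u z)"
    using fin finite_row[OF x(1)] x V_subset_S
    by (intro row_op_eq_sum) (auto simp: diffusion_matrix_def)
  also have "\<dots> = (t + real (card ?M)) *\<^sub>R u x + (\<Sum>z\<in>?M. - u z)"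
    using fin x by (auto simp: diffusion_matrix_def intro!: sum.cong)
  also have "\<dots> = t *\<^sub>R u x + (\<Sum>z\<in>?M. u x - u z)"
    by (simp add: sum_negf sum_subtractf scaleR_left_distrib sum_constant_scaleR)
  finally show ?thesis .
qed

text \<open>Constants are annihilated by the Laplacian and by the boundary differences, so only the
  absorption remains.\<close>

lemma row_sum:
  "x \<in> S \<Longrightarrow> row_op S a (\<lambda>_. 1::real) x = (if x \<in> V then \<alpha> else t)"
  by (simp add: row_op_interior row_op_boundary)

sublocale killed_laplacian S a
proof
  show "a x z = a z x" for x z
    by (auto simp: diffusion_matrix_def dest: adj_sym)
  show "finite {z \<in> S. a x z \<noteq> 0}" if "x \<in> S" for x
    by (rule finite_row[OF that])
  show "a x z \<le> 0" if "x \<noteq> z" for x z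
    using that by (auto simp: diffusion_matrix_def)
  show "0 \<le> row_op S a (\<lambda>_. 1::real) x" if "x \<in> S" for x
    using that \<alpha> t by (simp add: row_sum)
  show "0 < row_op S a (\<lambda>_. 1::real) x \<or>
      (\<exists>z\<in>S. z \<noteq> x \<and> a x z \<noteq> 0 \<and> 0 < row_op S a (\<lambda>_. 1::real) z)" if x: "x \<in> S" for x
  proof (cases "x \<in> V")
    case False
    \<comment> \<open>A boundary vertex may have zero row sum, but it has a neighbour in
      \<open>V\<close>, whose row sum is \<alpha>.\<close>
    then obtain z where z: "z \<in> V" "(x, z) \<in> parcs \<Gamma>"
      using boundary_neighbour x by blast
    then have "z \<in> S" "z \<noteq> x" "a x z \<noteq> 0"
      using False V_subset_S by (auto simp: diffusion_matrix_def)
    with z(1) \<alpha> show ?thesis by (auto simp: row_sum)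
  qed (use x \<alpha> in \<open>simp add: row_sum\<close>)
qed

abbreviation H\<^sub>0 :: "('a \<Rightarrow> complex) \<Rightarrow> 'a \<Rightarrow> complex" where
  "H\<^sub>0 \<equiv> diffusion_op \<Gamma> V \<alpha> t (\<lambda>_. 0)"

abbreviation D\<^sub>0 :: "('a \<Rightarrow> complex) set" where
  "D\<^sub>0 \<equiv> diffusion_dom \<Gamma> V \<alpha> t (\<lambda>_. 0)"

lemma diffusion_op_outside: "x \<notin> S \<Longrightarrow> diffusion_op \<Gamma> V \<alpha> t \<eta> u x = 0"
  by (simp add: diffusion_op_def vertex_closure_def)

lemma diffusion_op_eq_row_op:
  assumes x: "x \<in> S"
  shows "H\<^sub>0 u x = row_op S a u x"
proof (cases "x \<in> V")
  case True
  let ?f = "\<lambda>z. complex_of_real (laplacian \<Gamma> x z) * u z"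
  \<comment> \<open>All neighbours of an interior vertex lie in \<open>S\<close>, so the infinite
    sum reduces to the full finite row.\<close>
  have "infsum ?f S = infsum ?f (insert x (N x))"
    using True N_subset_S[OF True] V_subset_S
    by (intro infsum_cong_neutral) (auto simp: laplacian_def)
  also have "\<dots> = (\<Sum>z\<in>insert x (N x). ?f z)"
    using finite_N[OF x] by simp
  also have "\<dots> = of_nat (card (N x)) * u x + (\<Sum>z\<in>N x. - u z)"
    using finite_N[OF x] adj_irrefl
    by (auto simp: laplacian_def out_degree_eq intro!: sum.cong)
  finally show ?thesis
    using True by (simp add: diffusion_op_def row_op_interior sum_negf scaleR_conv_of_real algebra_simps)
next
  case False
  then show ?thesis
    using x by (simp add: diffusion_op_def row_op_boundary scaleR_conv_of_real)
      (simp add: vertex_closure_def)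
qed

lemma diffusion_op_point_absorber:
  assumes "y \<in> V"
  shows "diffusion_op \<Gamma> V \<alpha> t (point_absorber \<kappa> y) u x =
    H\<^sub>0 u x + of_real (\<alpha> * \<kappa>) * u y * of_bool (x = y)"
  using assms by (simp add: diffusion_op_def point_absorber_def algebra_simps)

lemma diffusion_op_add_cmult: "H\<^sub>0 (\<lambda>x. u x + k * v x) x = H\<^sub>0 u x + k * H\<^sub>0 v x"
  by (cases "x \<in> S") (simp_all add: diffusion_op_outside diffusion_op_eq_row_op row_op_add row_op_cmult)

lemma diffusion_dom_add_cmult: "u \<in> D\<^sub>0 \<Longrightarrow> v \<in> D\<^sub>0 \<Longrightarrow> (\<lambda>x. u x + k * v x) \<in> D\<^sub>0"
  by (simp add: diffusion_dom_def diffusion_op_add_cmult[abs_def] l2_on_add_cmult)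

text \<open>The perturbation only adds a multiple of the point mass at \<open>y\<close>, which is
  square summable, so the maximal domain does not change.\<close>

lemma diffusion_dom_point_absorber:
  assumes "y \<in> V"
  shows "diffusion_dom \<Gamma> V \<alpha> t (point_absorber \<kappa> y) = D\<^sub>0"
proof -
  have y: "y \<in> S" using assms V_subset_S by blast
  have "diffusion_op \<Gamma> V \<alpha> t (point_absorber \<kappa> y) u \<in> l2_on S \<longleftrightarrow> H\<^sub>0 u \<in> l2_on S" for u
  proof -
    let ?k = "of_real (\<alpha> * \<kappa>) * u y"
    let ?d = "\<lambda>x. ?k * of_bool (x = y)"
    have d: "?d \<in> l2_on S" by (rule l2_on_of_bool[OF y])
    have eq: "diffusion_op \<Gamma> V \<alpha> t (point_absorber \<kappa> y) u = (\<lambda>x. H\<^sub>0 u x + ?d x)"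
      by (rule ext) (rule diffusion_op_point_absorber[OF assms])
    show ?thesis
      unfolding eq using l2_on_add_cmult[OF _ d, of "H\<^sub>0 u" 1]
        l2_on_add_cmult[OF _ d, of "\<lambda>x. H\<^sub>0 u x + ?d x" "- 1"] by auto
  qed
  then show ?thesis by (auto simp: diffusion_dom_def)
qed

end

section \<open>Rank-one perturbation of the background operator\<close>

locale background_green = absorbing_graph +
  assumes G\<^sub>0_exists: "has_green \<Gamma> V \<alpha> t (\<lambda>_. 0)"
begin

abbreviation G\<^sub>0 :: "('a \<Rightarrow> complex) \<Rightarrow> 'a \<Rightarrow> complex" where
  "G\<^sub>0 \<equiv> green \<Gamma> V \<alpha> t (\<lambda>_. 0)"

lemma green_in_dom: "f \<in> l2_on S \<Longrightarrow> G\<^sub>0 f \<in> D\<^sub>0"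
  using G\<^sub>0_exists unfolding has_green_def green_def
  by (auto simp: bij_betw_def intro!: the_inv_into_into)

lemma diffusion_op_green: "f \<in> l2_on S \<Longrightarrow> H\<^sub>0 (G\<^sub>0 f) = f"
  using G\<^sub>0_exists unfolding has_green_def green_def by (rule f_the_inv_into_f_bij_betw) simp

lemma row_op_green: "f \<in> l2_on S \<Longrightarrow> x \<in> S \<Longrightarrow> row_op S a (G\<^sub>0 f) x = f x"
  using diffusion_op_green[of f] diffusion_op_eq_row_op[of x "G\<^sub>0 f"] by simp

lemma green_vanishes: "f \<in> l2_on S \<Longrightarrow> vanishes_at_infinity_on S (G\<^sub>0 f)"
  using green_in_dom[of f] by (auto simp: diffusion_dom_def intro: l2_on_vanishes_at_infinity)

lemma diffusion_op_inj: "u \<in> D\<^sub>0 \<Longrightarrow> v \<in> D\<^sub>0 \<Longrightarrow> H\<^sub>0 u = H\<^sub>0 v \<Longrightarrow> u = v"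
  using G\<^sub>0_exists by (auto simp: has_green_def bij_betw_def dest: inj_onD)

text \<open>Evaluation of \<open>G\<^sub>0 f\<close> at \<open>y\<close> becomes pairing with a
  column. The solvability required by reciprocity holds because a function dominated by
  \<open>f\<close> is again square summable.\<close>

lemma green_at_point:
  assumes y: "y \<in> S" and f: "f \<in> l2_on S"
  shows "((\<lambda>x. cnj (G\<^sub>0 (\<lambda>w. of_bool (w = y)) x) * f x) has_sum G\<^sub>0 f y) S"
proof (rule complex_green_reciprocity[OF y])
  have d: "(\<lambda>w. of_bool (w = y)) \<in> l2_on S"
    using l2_on_of_bool[OF y, of 1] by simp
  show "row_op S a (G\<^sub>0 (\<lambda>w. of_bool (w = y))) x = of_bool (x = y)" if "x \<in> S" for x
    using row_op_green[OF d that] .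
  show "vanishes_at_infinity_on S (G\<^sub>0 (\<lambda>w. of_bool (w = y)))"
    using green_vanishes[OF d] .
  show "row_op S a (G\<^sub>0 f) x = f x" if "x \<in> S" for x
    using row_op_green[OF f that] .
  show "vanishes_at_infinity_on S (G\<^sub>0 f)"
    using green_vanishes[OF f] .
  fix g :: "'a \<Rightarrow> real"
  assume g: "\<And>x. x \<in> S \<Longrightarrow> 0 \<le> g x \<and> g x \<le> norm (f x)"
  \<comment> \<open>Extended by zero, as membership in \<open>l2_on\<close> demands.\<close>
  define h where "h x = complex_of_real (if x \<in> S then g x else 0)" for x
  have h: "h \<in> l2_on S"
    using g by (intro l2_on_dominated[OF f]) (auto simp: h_def)
  have "row_op S a (\<lambda>x. Re (G\<^sub>0 h x)) x = g x" if "x \<in> S" for x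
    unfolding Re_row_op[symmetric] row_op_green[OF h that] using that by (simp add: h_def)
  then show "\<exists>v. (\<forall>x\<in>S. row_op S a v x = g x) \<and> vanishes_at_infinity_on S v"
    using vanishes_at_infinity_on_Re[OF green_vanishes[OF h]] by blast
qed

lemma green_diagonal_nonneg:
  assumes y: "y \<in> S"
  shows "0 \<le> Re (G\<^sub>0 (\<lambda>w. of_bool (w = y)) y)"
proof (rule green_nonneg(1)[where y = y and u = "G\<^sub>0 (\<lambda>w. of_bool (w = y))", OF _ _ y])
  have d: "(\<lambda>w. of_bool (w = y)) \<in> l2_on S"
    using l2_on_of_bool[OF y, of 1] by simp
  show "row_op S a (G\<^sub>0 (\<lambda>w. of_bool (w = y))) x = of_bool (x = y)" if "x \<in> S" for x
    using row_op_green[OF d that] .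
  show "vanishes_at_infinity_on S (G\<^sub>0 (\<lambda>w. of_bool (w = y)))"
    using green_vanishes[OF d] .
qed

text \<open>With \<beta> = \<alpha> \<kappa>, a solution u of the perturbed equation is
  \<open>G\<^sub>0 f\<close> minus \<beta> u(y) \<open>U\<close>. Evaluation at \<open>y\<close>
  determines u(y), and \<beta> u(y) equals \<open>c * G\<^sub>0 f y\<close>. The denominator is
  nonzero because its real part is at least 1.\<close>

lemma sherman_morrison:
  fixes \<kappa> :: real
  assumes yV: "y \<in> V" and \<kappa>: "\<kappa> > 0"
  defines "U \<equiv> G\<^sub>0 (\<lambda>w. of_bool (w = y))"
  defines "c \<equiv> of_real (\<alpha> * \<kappa>) / (1 + of_real (\<alpha> * \<kappa>) * U y)"
  shows "has_green \<Gamma> V \<alpha> t (point_absorber \<kappa> y)"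
    and "f \<in> l2_on S \<Longrightarrow> green \<Gamma> V \<alpha> t (point_absorber \<kappa> y) f = (\<lambda>x. G\<^sub>0 f x - c * G\<^sub>0 f y * U x)"
proof -
  let ?\<beta> = "complex_of_real (\<alpha> * \<kappa>)"
  let ?H = "diffusion_op \<Gamma> V \<alpha> t (point_absorber \<kappa> y)"
  have y: "y \<in> S" using yV V_subset_S by blast
  have d: "(\<lambda>w. of_bool (w = y)) \<in> l2_on S"
    using l2_on_of_bool[OF y, of 1] by simp
  have UD: "U \<in> D\<^sub>0" and HU: "H\<^sub>0 U = (\<lambda>w. of_bool (w = y))"
    unfolding U_def using green_in_dom[OF d] diffusion_op_green[OF d] by auto
  have "0 \<le> \<alpha> * \<kappa> * Re (U y)"
    unfolding U_def using green_diagonal_nonneg[OF y] \<alpha> \<kappa> by simp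
  then have "Re (1 + ?\<beta> * U y) \<noteq> 0" by simp
  then have nz: "1 + ?\<beta> * U y \<noteq> 0" by (metis zero_complex.sel(1))
  have c: "c * (1 + ?\<beta> * U y) = ?\<beta>"
    using nz by (simp add: c_def)
  note H = diffusion_op_point_absorber[OF yV, of \<kappa>]
  define h where "h f x = G\<^sub>0 f x + (- c * G\<^sub>0 f y) * U x" for f x
  have hD: "h f \<in> D\<^sub>0" and Hh: "?H (h f) = f" if f: "f \<in> l2_on S" for f
  proof -
    show "h f \<in> D\<^sub>0"
      unfolding h_def[abs_def] by (intro diffusion_dom_add_cmult green_in_dom f UD)
    have "?H (h f) x = f x" for x
    proof -
      \<comment> \<open>The corrections collect into a point mass at \<open>y\<close> whose
        coefficient vanishes by the choice of \<open>c\<close>.\<close>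
      have "?H (h f) x = f x + (?\<beta> - c * (1 + ?\<beta> * U y)) * G\<^sub>0 f y * of_bool (x = y)"
        unfolding H h_def[abs_def] diffusion_op_add_cmult diffusion_op_green[OF f] HU
        by (simp add: algebra_simps)
      then show ?thesis using c by simp
    qed
    then show "?H (h f) = f" by blast
  qed
  have inj: "inj_on ?H D\<^sub>0"
  proof (rule inj_onI)
    fix u v assume u: "u \<in> D\<^sub>0" and v: "v \<in> D\<^sub>0" and eq: "?H u = ?H v"
    let ?s = "u y - v y"
    \<comment> \<open>Equal images mean that \<open>H\<^sub>0\<close> maps u - v to a multiple of
      the point mass at \<open>y\<close>, hence u - v is a multiple of \<open>U\<close>; its value
      at \<open>y\<close> then satisfies a homogeneous scalar equation.\<close>
    have "H\<^sub>0 u x = H\<^sub>0 v x + (- ?\<beta> * ?s) * H\<^sub>0 U x" for x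
      using fun_cong[OF eq, of x] by (simp add: H HU algebra_simps)
    then have "H\<^sub>0 u = H\<^sub>0 (\<lambda>x. v x + (- ?\<beta> * ?s) * U x)"
      by (intro ext) (simp only: diffusion_op_add_cmult)
    then have uv: "u = (\<lambda>x. v x + (- ?\<beta> * ?s) * U x)"
      by (rule diffusion_op_inj[OF u diffusion_dom_add_cmult[OF v UD]])
    have "?s * (1 + ?\<beta> * U y) = 0"
      using fun_cong[OF uv, of y] by (simp add: algebra_simps)
    then have "?s = 0" using nz by simp
    then show "u = v" using uv by simp
  qed
  have "bij_betw ?H D\<^sub>0 (l2_on S)"
    unfolding bij_betw_def
  proof (intro conjI inj subset_antisym)
    show "?H ` D\<^sub>0 \<subseteq> l2_on S"
      unfolding diffusion_dom_point_absorber[OF yV, of \<kappa>, symmetric] by (auto simp: diffusion_dom_def)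
    show "l2_on S \<subseteq> ?H ` D\<^sub>0"
    proof
      show "f \<in> ?H ` D\<^sub>0" if "f \<in> l2_on S" for f
        using imageI[OF hD[OF that], of ?H] Hh[OF that] by simp
    qed
  qed
  then show "has_green \<Gamma> V \<alpha> t (point_absorber \<kappa> y)"
    by (simp add: has_green_def diffusion_dom_point_absorber[OF yV])
  show "green \<Gamma> V \<alpha> t (point_absorber \<kappa> y) f = (\<lambda>x. G\<^sub>0 f x - c * G\<^sub>0 f y * U x)"
    if f: "f \<in> l2_on S"
  proof -
    have "green \<Gamma> V \<alpha> t (point_absorber \<kappa> y) f = h f"
      unfolding green_def diffusion_dom_point_absorber[OF yV]
      by (rule the_inv_into_f_eq[OF inj Hh[OF f] hD[OF f]])
    then show ?thesis by (simp add: h_def[abs_def])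
  qed
qed

end

section \<open>The rank-one formula for kernels and operators\<close>

theorem theorem11:
  fixes \<Gamma> :: "'a pair_pre_digraph" and V :: "'a set" and y :: 'a
    and \<alpha>\<^sub>0 t \<kappa> :: real
  defines "S \<equiv> vertex_closure \<Gamma> V"
    and "G\<^sub>0 \<equiv> green \<Gamma> V \<alpha>\<^sub>0 t (\<lambda>_. 0)"
    and "G \<equiv> green \<Gamma> V \<alpha>\<^sub>0 t (point_absorber \<kappa> y)"
    and "K\<^sub>0 \<equiv> green_kernel \<Gamma> V \<alpha>\<^sub>0 t (\<lambda>_. 0)"
    and "K \<equiv> green_kernel \<Gamma> V \<alpha>\<^sub>0 t (point_absorber \<kappa> y)"
  defines "c \<equiv> of_real (\<alpha>\<^sub>0 * \<kappa>) / (1 + of_real (\<alpha>\<^sub>0 * \<kappa>) * K\<^sub>0 y y)"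
  assumes graph: "pair_bidirected_digraph \<Gamma>"
    and conn: "Digraph_Component.connected \<Gamma>"
    and locfin: "locally_finite \<Gamma>"
    and V: "V \<subseteq> pverts \<Gamma>"
    and \<alpha>\<^sub>0: "\<alpha>\<^sub>0 > 0"
    and t: "t \<ge> 0"
    and G\<^sub>0_exists: "has_green \<Gamma> V \<alpha>\<^sub>0 t (\<lambda>_. 0)"
    and y: "y \<in> V"
    and \<kappa>: "\<kappa> > 0"
  shows "has_green \<Gamma> V \<alpha>\<^sub>0 t (point_absorber \<kappa> y)
    \<and> (\<forall>x\<in>S. \<forall>z\<in>S. K\<^sub>0 x z - K x z = c * (K\<^sub>0 x y * cnj (K\<^sub>0 z y)))
    \<and> (\<forall>f\<in>l2_on S. \<forall>x\<in>S.
          G\<^sub>0 f x - G f x = c * rank_one_on S (\<lambda>w. K\<^sub>0 w y) (\<lambda>w. K\<^sub>0 w y) f x)"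
proof -
  interpret background_green \<Gamma> V \<alpha>\<^sub>0 t
    by (intro background_green.intro absorbing_graph.intro background_green_axioms.intro
        graph locfin V \<alpha>\<^sub>0 t G\<^sub>0_exists)
  have yS: "y \<in> S" using y V_subset_S by (auto simp: S_def)
  have U: "K\<^sub>0 w z = G\<^sub>0 (\<lambda>w. of_bool (w = z)) w" for w z
    by (simp add: K\<^sub>0_def G\<^sub>0_def green_kernel_def)
  have main: "G\<^sub>0 f x - G f x = c * rank_one_on S (\<lambda>w. K\<^sub>0 w y) (\<lambda>w. K\<^sub>0 w y) f x"
    if f: "f \<in> l2_on S" for f x
  proof -
    have "(\<Sum>\<^sub>\<infinity>z\<in>S. cnj (K\<^sub>0 z y) * f z) = G\<^sub>0 f y"
      using green_at_point[of y f] yS f unfolding S_def G\<^sub>0_def K\<^sub>0_def green_kernel_def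
      by (intro infsumI)
    moreover have "G f = (\<lambda>x. G\<^sub>0 f x - c * G\<^sub>0 f y * K\<^sub>0 x y)"
      using sherman_morrison(2)[OF y \<kappa>, of f] f
      unfolding S_def G\<^sub>0_def K\<^sub>0_def green_kernel_def G_def c_def by simp
    ultimately show ?thesis
      by (simp add: rank_one_on_def)
  qed
  have "K\<^sub>0 x z - K x z = c * (K\<^sub>0 x y * cnj (K\<^sub>0 z y))" if z: "z \<in> S" for x z
  proof -
    \<comment> \<open>The kernel identity is the operator identity applied to the point mass at
      \<open>z\<close>, for which the pairing collapses to one term.\<close>
    let ?f = "\<lambda>w. of_bool (w = z) :: complex"
    have "?f \<in> l2_on S"
      using l2_on_of_bool[of z S 1] z by simp
    moreover have "(\<Sum>\<^sub>\<infinity>w\<in>S. cnj (K\<^sub>0 w y) * ?f w) = (\<Sum>\<^sub>\<infinity>w\<in>{z}. cnj (K\<^sub>0 w y) * ?f w)"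
      using z by (intro infsum_cong_neutral) auto
    moreover have "K x z = G ?f x" by (simp add: K_def G_def green_kernel_def)
    ultimately show ?thesis
      using main[of ?f x] by (simp add: U rank_one_on_def)
  qed
  with main sherman_morrison(1)[OF y \<kappa>] show ?thesis
    by blast
qed

end
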